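(* Let $t\neq 0$, and let $D_n$ ($n\ge 0$) be the shifted derangement numbers. For every integer $n\ge 0$, $$\sum_{k=0}^n \frac{(-1)^k}{t^k} \left( \frac{D_{k+2} +(t-1)(k+2)D_{k}}{k+2}\right) = \frac{(-1)^n}{t^n}D_{n+1}.$$
   Context: The shifted derangement numbers are defined by $D_0=0$, $D_1=1$ and $D_{n+2}=(n+2)D_{n+1}+(n+2)D_n$ for $n\ge 0$; equivalently $D_n=d_{n+1}$, where $d_m$ is the number of permutations of $m$ letters with no fixed points. Here $t$ is an indeterminate, which may be specialized to any nonzero complex number. *)

theory Defs
  imports "HOL-Computational_Algebra.Computational_Algebra"
begin

fun shifted_derangement :: "nat \<Rightarrow> nat" where
  "shifted_derangement 0 = 0"
| "shifted_derangement (Suc 0) = 1"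
| "shifted_derangement (Suc (Suc n)) =
     (n + 2) * shifted_derangement (Suc n) + (n + 2) * shifted_derangement n"

end

theory Submission
  imports Defs
begin

text \<open>Write D for \<open>shifted_derangement\<close>. The recurrence cancels the denominator
  \<open>k + 2\<close>, reducing the fraction to D(k+1) + t D(k). With a(k) = (-1)^k D(k+1) / t^k,
  the k-th term is then a(k) - a(k-1) for k > 0, so the sum telescopes to a(n); nothing is left at k
  = 0 because D(0) = 0.\<close>

lemma shifted_derangement_summand:
  fixes t :: "'a :: field_char_0"
  shows "(of_nat (shifted_derangement (k + 2))
            + (t - 1) * of_nat (k + 2) * of_nat (shifted_derangement k)) / of_nat (k + 2)
         = of_nat (shifted_derangement (k + 1)) + t * of_nat (shifted_derangement k)"
proof -
  have nz: "(of_nat (k + 2) :: 'a) \<noteq> 0"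
    by (simp only: of_nat_eq_0_iff)
  have rec: "shifted_derangement (k + 2)
      = (k + 2) * (shifted_derangement (k + 1) + shifted_derangement k)"
    by (simp add: numeral_2_eq_2 algebra_simps)
  \<comment> \<open>Generic \<open>a\<close>, \<open>b\<close>, \<open>c\<close> keep
    \<open>of_nat (k + 2)\<close> atomic during the cancellation.\<close>
  have "(c * (a + b) + (t - 1) * c * b) / c = a + t * b" if "c \<noteq> 0" for a b c :: 'a
    using that by (simp add: field_simps)
  from this[OF nz] show ?thesis
    by (simp only: rec of_nat_mult of_nat_add[of "shifted_derangement (k + 1)"])
qed

theorem mainTheorem9:
  fixes t :: "'a :: field_char_0" and n :: nat
  assumes "t \<noteq> 0"
  shows "(\<Sum>k=0..n. ((-1) ^ k / t ^ k) *
            ((of_nat (shifted_derangement (k + 2))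
              + (t - 1) * of_nat (k + 2) * of_nat (shifted_derangement k)) / of_nat (k + 2)))
         = ((-1) ^ n / t ^ n) * of_nat (shifted_derangement (n + 1))"
  unfolding shifted_derangement_summand
proof (induction n)
  case 0
  show ?case by simp
next
  case (Suc n)
  \<comment> \<open>The factor \<open>t\<close> lowers the power and the sign flips: at x = D(n+1)
    this cancels the sum given by the induction hypothesis.\<close>
  have "(-1) ^ Suc n / t ^ Suc n * (t * x) = - ((-1) ^ n / t ^ n * x)" for x
    using assms by simp
  with Suc.IH show ?case
    by (simp only: sum.atLeast0_atMost_Suc distrib_left) simp
qed

end
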